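(* Let $X=\{X_j, j\ge 1\}$ be a sequence of independent random variables taking values in $\mathbb{Z}$, and let $S_n=\sum_{k=1}^nX_k$. Assume that $\vartheta_{X_j}>0$ for each $j$ and that the series $\sum_{j=1}^\infty\vartheta_{X_j}$ diverges. Put $\nu_n=\sum_{j=1}^n\vartheta_{X_j}$. Let $0<\rho<1$ and $0<\varepsilon<1$. Then for each $n$ such that $$|x|\le\frac12\sqrt{\frac{2}{\big((1-\varepsilon)\nu_n\big)^{1-\rho}}}\quad\Longrightarrow\quad\frac{\sin x}{x}\ge\sqrt{1-\varepsilon}$$ (for real $x$, with $\frac{\sin x}{x}$ read as $1$ at $x=0$), we have $$\sup_{u\ge 0}\ \sup_{d<(\pi/\sqrt2)\,((1-\varepsilon)\nu_n)^{(1-\rho)/2}}\Big|\mathbb{P}\{d\,|\,S_n+u\}-\frac1d\Big|\le 2\,e^{-\frac{\varepsilon^2}{2}\nu_n}+e^{-((1-\varepsilon)\nu_n)^\rho},$$ where $u$ runs over the nonnegative integers and $d$ over the positive integers in the indicated range.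
   Context: For a random variable $Y$ with values in $\mathbb{Z}$, $\vartheta_Y=\sum_{k\in\mathbb{Z}}\mathbb{P}\{Y=k\}\wedge\mathbb{P}\{Y=k+1\}$, where $a\wedge b=\min(a,b)$. The notation $d\,|\,N$ means that $d$ divides the integer $N$. *)

theory Defs
  imports "HOL-Probability.Probability"
begin

definition vartheta :: "'a measure \<Rightarrow> ('a \<Rightarrow> int) \<Rightarrow> real" where
  "vartheta M Y =
     (\<Sum>\<^sub>\<infinity>k\<in>UNIV. min (measure M {\<omega> \<in> space M. Y \<omega> = k})
                     (measure M {\<omega> \<in> space M. Y \<omega> = k + 1}))"

text \<open>The sequence is indexed by the positive integers; \<open>X 0\<close> is never used.\<close>

definition partial_sum :: "(nat \<Rightarrow> 'a \<Rightarrow> int) \<Rightarrow> nat \<Rightarrow> 'a \<Rightarrow> int" where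
  "partial_sum X n \<omega> = (\<Sum>k = 1..n. X k \<omega>)"

definition nu :: "'a measure \<Rightarrow> (nat \<Rightarrow> 'a \<Rightarrow> int) \<Rightarrow> nat \<Rightarrow> real" where
  "nu M X n = (\<Sum>j = 1..n. vartheta M (X j))"

end

theory Submission
  imports Defs
begin

text \<open>
  By orthogonality of the \<open>d\<close>-th roots of unity, the deviation of the probability from \<open>1/d\<close> is at
  most the average over \<open>j < d\<close>, with the term \<open>j = 0\<close> omitted, of the modulus of the
  characteristic function of \<open>S\<^sub>n\<close> at \<open>2\<pi>j/d\<close>. Splitting off from each \<open>X\<^sub>k\<close> its fair-coin part
  of mass \<open>\<vartheta>\<^sub>k\<close> bounds that modulus by \<open>exp (-\<nu>\<^sub>n (1 - \<bar>cos (\<pi>j/d)\<bar>)) \<le> exp (-2\<nu>\<^sub>n (sin (\<pi>/(2d)))\<^sup>2)\<close>,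
  which the sine hypothesis makes at most the second summand of the claimed bound.
\<close>

section \<open>Integration against the law of an integer-valued variable\<close>

lemma measurable_sum_int:
  fixes f :: "'i \<Rightarrow> 'a \<Rightarrow> int"
  assumes "\<And>i. i \<in> I \<Longrightarrow> f i \<in> measurable M (count_space UNIV)"
  shows "(\<lambda>x. \<Sum>i\<in>I. f i x) \<in> measurable M (count_space UNIV)"
  using assms
proof (induction I rule: infinite_finite_induct)
  case (insert i I)
  then have [measurable]: "f i \<in> measurable M (count_space UNIV)"
    "(\<lambda>x. \<Sum>i\<in>I. f i x) \<in> measurable M (count_space UNIV)"
    by auto
  show ?case using insert.hyps by simp
qed auto

text \<open>The law has the point masses as density with respect to counting measure, since measures
  on a countable discrete space are determined by singletons. \<open>f\<close> may be arbitrary: if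
  it is not integrable, both sides take the default value \<open>0\<close>.\<close>

lemma (in prob_space) integral_int_valued:
  fixes Y :: "'a \<Rightarrow> int" and f :: "int \<Rightarrow> 'b::{banach, second_countable_topology}"
  assumes [measurable]: "Y \<in> measurable M (count_space UNIV)"
  shows "(LINT \<omega>|M. f (Y \<omega>)) = (LINT k|count_space UNIV. prob {\<omega> \<in> space M. Y \<omega> = k} *\<^sub>R f k)"
    and "integrable (count_space UNIV) (\<lambda>k. prob {\<omega> \<in> space M. Y \<omega> = k})"
    and "(LINT k|count_space UNIV. prob {\<omega> \<in> space M. Y \<omega> = k}) = 1"
proof -
  define p where "p k = prob {\<omega> \<in> space M. Y \<omega> = k}" for k
  have eq: "distr M (count_space UNIV) Y = density (count_space UNIV) (\<lambda>k. ennreal (p k))"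
  proof (rule measure_eqI_countable[where A = UNIV])
    fix k
    have "emeasure (distr M (count_space UNIV) Y) {k} = emeasure M {\<omega> \<in> space M. Y \<omega> = k}"
      by (subst emeasure_distr) (auto intro!: arg_cong[where f = "emeasure M"])
    also have "\<dots> = emeasure (density (count_space UNIV) (\<lambda>k. ennreal (p k))) {k}"
      by (simp add: emeasure_density p_def emeasure_eq_measure nn_integral_count_space_indicator[symmetric])
    finally show "emeasure (distr M (count_space UNIV) Y) {k} =
      emeasure (density (count_space UNIV) (\<lambda>k. ennreal (p k))) {k}" .
  qed auto
  have tr: "(LINT \<omega>|M. g (Y \<omega>)) = (LINT k|count_space UNIV. p k *\<^sub>R g k)"
    for g :: "int \<Rightarrow> 'c::{banach, second_countable_topology}"
  proof -
    have "(LINT \<omega>|M. g (Y \<omega>)) = (LINT k|distr M (count_space UNIV) Y. g k)"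
      by (subst integral_distr) auto
    also have "\<dots> = (LINT k|count_space UNIV. p k *\<^sub>R g k)"
      unfolding eq by (subst integral_density) (auto simp: p_def)
    finally show ?thesis .
  qed
  show "(LINT \<omega>|M. f (Y \<omega>)) = (LINT k|count_space UNIV. prob {\<omega> \<in> space M. Y \<omega> = k} *\<^sub>R f k)"
    using tr[of f] by (simp add: p_def)
  show one: "(LINT k|count_space UNIV. prob {\<omega> \<in> space M. Y \<omega> = k}) = 1"
    using tr[of "\<lambda>_. 1 :: real"] by (simp add: p_def prob_space)
  show "integrable (count_space UNIV) (\<lambda>k. prob {\<omega> \<in> space M. Y \<omega> = k})"
    \<comment> \<open>A non-integrable function would have Bochner integral \<open>0\<close>, so the
      value \<open>1\<close> forces integrability.\<close>
    using one not_integrable_integral_eq by fastforce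
qed

section \<open>Characteristic function of a single integer-valued variable\<close>

lemma norm_cis_add_cis: "norm (cis a + cis b) = 2 * \<bar>cos ((a - b) / 2)\<bar>"
proof -
  have "cis a + cis b = of_real (2 * cos ((a - b) / 2)) * cis ((a + b) / 2)"
    by (simp add: complex_eq_iff cos_plus_cos sin_plus_sin)
  then show ?thesis
    by (simp add: norm_mult)
qed

text \<open>
  Since \<open>p\<^sub>k \<ge> (m\<^sub>k + m\<^sub>k\<^sub>-\<^sub>1) / 2\<close> for \<open>m\<^sub>k = min p\<^sub>k p\<^sub>k\<^sub>+\<^sub>1\<close>, the law of \<open>Y\<close> contains the
  sum over \<open>k\<close> of \<open>m\<^sub>k\<close> times a fair coin on \<open>{k, k + 1}\<close>; each coin contributes a factor
  \<open>\<bar>cos (t/2)\<bar>\<close>, and the rest is bounded trivially.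
\<close>

lemma (in prob_space) norm_char_int_valued_le:
  fixes Y :: "'a \<Rightarrow> int"
  assumes Y[measurable]: "Y \<in> measurable M (count_space UNIV)"
  shows "norm (char (distr M borel (\<lambda>\<omega>. real_of_int (Y \<omega>))) t)
    \<le> 1 - vartheta M Y * (1 - \<bar>cos (t / 2)\<bar>)"
proof -
  define p where "p k = prob {\<omega> \<in> space M. Y \<omega> = k}" for k
  define m where "m k = min (p k) (p (k + 1))" for k
  define q where "q k = p k - (m k + m (k - 1)) / 2" for k
  define e where "e k = cis (t * of_int k)" for k :: int
  let ?C = "count_space (UNIV :: int set)"
  have p: "integrable ?C p" "(LINT k|?C. p k) = 1"
    using integral_int_valued(2,3)[OF Y] by (simp_all add: p_def[abs_def])
  have p0: "p k \<ge> 0" for k by (simp add: p_def)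
  have m0: "m k \<ge> 0" for k by (simp add: m_def p0)
  have q0: "q k \<ge> 0" for k by (simp add: q_def m_def min_def)
  have m: "integrable ?C m"
    by (rule Bochner_Integration.integrable_bound[OF p(1)]) (auto simp: m_def p0)
  have shift: "bij_betw (\<lambda>k::int. k - 1) UNIV UNIV"
    by (rule bij_betwI[where g = "\<lambda>k. k + 1"]) auto
  have m': "integrable ?C (\<lambda>k. m (k - 1))"
    using integrable_bij_count_space[OF shift, of m] m by simp
  have im': "(LINT k|?C. m (k - 1)) = (LINT k|?C. m k)"
    using integral_bij_count_space[OF shift, of m] by simp
  \<comment> \<open>Integrability of \<open>m\<close> lets the unordered sum in
    \<open>vartheta\<close> be read as an integral over counting measure.\<close>
  have theta: "vartheta M Y = (LINT k|?C. m k)"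
    using infsetsum_infsum[of m UNIV] m
    by (simp add: vartheta_def infsetsum_def abs_summable_on_def m_def[abs_def] p_def)
  have ne: "norm (e k) = 1" for k by (simp add: e_def)
  have ie: "integrable ?C (\<lambda>k. g k *\<^sub>R e (h k))" if "integrable ?C g" for g h
    by (rule Bochner_Integration.integrable_bound[OF that]) (auto simp: ne)
  have q: "integrable ?C q"
    unfolding q_def[abs_def] using p m m' by auto
  \<comment> \<open>\<open>q\<close> is what remains of \<open>p\<close> after two half-copies of
    \<open>m\<close>, each of mass \<open>vartheta M Y / 2\<close>, are removed.\<close>
  have iq: "(LINT k|?C. q k) = 1 - vartheta M Y"
    unfolding q_def using p m m' by (simp add: theta im')
  have "char (distr M borel (\<lambda>\<omega>. real_of_int (Y \<omega>))) t = (LINT \<omega>|M. e (Y \<omega>))"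
    unfolding char_def by (subst integral_distr) (auto simp: e_def cis_conv_exp)
  also have "\<dots> = (LINT k|?C. p k *\<^sub>R e k)"
    using integral_int_valued(1)[OF Y, of e] by (simp add: p_def)
  also have "\<dots> = (LINT k|?C. q k *\<^sub>R e k + (1/2) *\<^sub>R (m k *\<^sub>R e k) + (1/2) *\<^sub>R (m (k - 1) *\<^sub>R e k))"
    by (intro Bochner_Integration.integral_cong refl)
       (simp add: q_def scaleR_conv_of_real field_simps)
  also have "\<dots> = (LINT k|?C. q k *\<^sub>R e k) + (1/2) *\<^sub>R (LINT k|?C. m k *\<^sub>R e k)
      + (1/2) *\<^sub>R (LINT k|?C. m (k - 1) *\<^sub>R e k)"
    using ie[OF q, of "\<lambda>k. k"] ie[OF m, of "\<lambda>k. k"] ie[OF m', of "\<lambda>k. k"]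
    by (simp del: scaleR_scaleR)
  \<comment> \<open>Shifting the index attaches the weight \<open>m k\<close> to both faces
    \<open>k\<close> and \<open>k + 1\<close> of its coin.\<close>
  also have "(LINT k|?C. m (k - 1) *\<^sub>R e k) = (LINT k|?C. m k *\<^sub>R e (k + 1))"
    using integral_bij_count_space[OF shift, of "\<lambda>k. m k *\<^sub>R e (k + 1)"] by simp
  also have "(LINT k|?C. q k *\<^sub>R e k) + (1/2) *\<^sub>R (LINT k|?C. m k *\<^sub>R e k)
      + (1/2) *\<^sub>R (LINT k|?C. m k *\<^sub>R e (k + 1))
    = (LINT k|?C. q k *\<^sub>R e k) + (1/2) *\<^sub>R (LINT k|?C. m k *\<^sub>R (e k + e (k + 1)))"
    using ie[OF m, of "\<lambda>k. k"] ie[OF m, of "\<lambda>k. k + 1"]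
    by (simp add: scaleR_add_right[symmetric] del: scaleR_add_right)
       (simp add: scaleR_add_right)
  also have "norm \<dots> \<le> norm (LINT k|?C. q k *\<^sub>R e k)
      + (1/2) * norm (LINT k|?C. m k *\<^sub>R (e k + e (k + 1)))"
    by (rule norm_triangle_le) simp
  also have "\<dots> \<le> (LINT k|?C. norm (q k *\<^sub>R e k))
      + (1/2) * (LINT k|?C. norm (m k *\<^sub>R (e k + e (k + 1))))"
    by (intro add_mono mult_left_mono integral_norm_bound) auto
  also have "(LINT k|?C. norm (q k *\<^sub>R e k)) = 1 - vartheta M Y"
    using iq by (simp add: ne q0)
  also have "(\<lambda>k. norm (m k *\<^sub>R (e k + e (k + 1)))) = (\<lambda>k. m k * (2 * \<bar>cos (t / 2)\<bar>))"
  proof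
    fix k
    have "norm (e k + e (k + 1)) = 2 * \<bar>cos (- (t / 2))\<bar>"
      unfolding e_def norm_cis_add_cis by (simp add: algebra_simps)
    then show "norm (m k *\<^sub>R (e k + e (k + 1))) = m k * (2 * \<bar>cos (t / 2)\<bar>)"
      by (simp add: m0 del: scaleR_add_right)
  qed
  also have "(LINT k|?C. m k * (2 * \<bar>cos (t / 2)\<bar>)) = vartheta M Y * (2 * \<bar>cos (t / 2)\<bar>)"
    by (simp add: theta)
  finally show ?thesis by (simp add: algebra_simps)
qed

section \<open>Divisibility through roots of unity\<close>

text \<open>The terms form a geometric progression whose ratio is a \<open>d\<close>-th root of
  unity, equal to \<open>1\<close> exactly when \<open>d\<close> divides \<open>m\<close>.\<close>

lemma sum_cis_roots_of_unity:
  fixes d :: nat and m :: int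
  assumes "d \<ge> 1"
  shows "(\<Sum>j<d. cis (2 * pi * real j / real d * of_int m)) = (if int d dvd m then of_nat d else 0)"
proof -
  define z where "z = cis (2 * pi * (of_int m / real d))"
  have pow: "cis (2 * pi * real j / real d * of_int m) = z ^ j" for j
    unfolding z_def Complex.DeMoivre by (simp add: field_simps)
  have zd: "z ^ d = 1"
    using assms by (simp add: z_def Complex.DeMoivre)
  show ?thesis
  proof (cases "int d dvd m")
    case True
    then have "z = 1"
      using assms cis_multiple_2pi by (auto simp: z_def mult.assoc elim!: dvdE)
    with True show ?thesis unfolding pow by simp
  next
    case False
    have "z \<noteq> 1"
    proof
      assume "z = 1"
      then obtain x :: int where "2 * pi * (of_int m / real d) = of_int x * 2 * pi"
        by (auto simp: z_def complex_eq_iff cos_one_2pi_int)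
      then have "of_int m = (of_int (x * int d) :: real)"
        using assms by (simp add: field_simps)
      then have "m = x * int d" by (simp only: of_int_eq_iff)
      with False show False by simp
    qed
    with False zd show ?thesis unfolding pow by (simp add: geometric_sum)
  qed
qed

text \<open>The indicator of the event is an average of \<open>d\<close> characters; expectation
  turns each into a value of the characteristic function. The shift \<open>u\<close> enters only
  through factors of modulus one, so the bound is uniform in \<open>u\<close>.\<close>

lemma (in prob_space) prob_dvd_diff_le:
  fixes Y :: "'a \<Rightarrow> int" and u :: int
  assumes Y[measurable]: "Y \<in> measurable M (count_space UNIV)" and d: "d \<ge> 1"
  shows "\<bar>prob {\<omega> \<in> space M. int d dvd Y \<omega> + u} - 1 / real d\<bar>
    \<le> (\<Sum>j\<in>{1..<d}. norm (char (distr M borel (\<lambda>\<omega>. real_of_int (Y \<omega>))) (2 * pi * real j / real d))) / real d"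
proof -
  define \<phi> where "\<phi> = char (distr M borel (\<lambda>\<omega>. real_of_int (Y \<omega>)))"
  define a where "a j = 2 * pi * real j / real d" for j :: nat
  have \<phi>: "\<phi> t = (LINT \<omega>|M. cis (t * of_int (Y \<omega>)))" for t
    unfolding \<phi>_def char_def by (subst integral_distr) (auto simp: cis_conv_exp)
  have int: "integrable M (\<lambda>\<omega>. cis (t * of_int (Y \<omega>)))" for t
    by (rule integrable_const_bound[where B = 1]) auto
  have A: "{\<omega> \<in> space M. int d dvd Y \<omega> + u} \<in> events" by measurable
  have "complex_of_real (prob {\<omega> \<in> space M. int d dvd Y \<omega> + u})
      = (LINT \<omega>|M. complex_of_real (indicat_real {\<omega> \<in> space M. int d dvd Y \<omega> + u} \<omega>))"
    using A by simp
  also have "\<dots> = (LINT \<omega>|M. (\<Sum>j<d. cis (a j * of_int u) * cis (a j * of_int (Y \<omega>))) / of_nat d)"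
  proof (intro Bochner_Integration.integral_cong refl)
    fix \<omega> assume "\<omega> \<in> space M"
    have "(\<Sum>j<d. cis (a j * of_int u) * cis (a j * of_int (Y \<omega>)))
        = (\<Sum>j<d. cis (2 * pi * real j / real d * of_int (Y \<omega> + u)))"
      by (intro sum.cong refl) (simp add: a_def cis_mult algebra_simps add_divide_distrib)
    also note sum_cis_roots_of_unity[OF d]
    finally show "complex_of_real (indicat_real {\<omega> \<in> space M. int d dvd Y \<omega> + u} \<omega>)
        = (\<Sum>j<d. cis (a j * of_int u) * cis (a j * of_int (Y \<omega>))) / of_nat d"
      using d \<open>\<omega> \<in> space M\<close> by (simp add: indicator_def)
  qed
  also have "\<dots> = (\<Sum>j<d. cis (a j * of_int u) * \<phi> (a j)) / of_nat d"
    using int by (simp add: \<phi>)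
  \<comment> \<open>The frequency \<open>j = 0\<close> contributes \<open>1\<close>, which after
    division by \<open>d\<close> is the main term.\<close>
  also have "{..<d} = insert 0 {1..<d}" using d by auto
  also have "(\<Sum>j\<in>insert 0 {1..<d}. cis (a j * of_int u) * \<phi> (a j))
      = 1 + (\<Sum>j\<in>{1..<d}. cis (a j * of_int u) * \<phi> (a j))"
    by (simp add: a_def \<phi> prob_space)
  finally have "complex_of_real (prob {\<omega> \<in> space M. int d dvd Y \<omega> + u} - 1 / real d)
      = (\<Sum>j\<in>{1..<d}. cis (a j * of_int u) * \<phi> (a j)) / of_nat d"
    by (simp add: add_divide_distrib)
  from arg_cong[OF this, of norm]
  have "\<bar>prob {\<omega> \<in> space M. int d dvd Y \<omega> + u} - 1 / real d\<bar>
      = norm ((\<Sum>j\<in>{1..<d}. cis (a j * of_int u) * \<phi> (a j)) / of_nat d)"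
    by (simp only: norm_of_real)
  also have "\<dots> \<le> (\<Sum>j\<in>{1..<d}. norm (cis (a j * of_int u) * \<phi> (a j))) / real d"
    by (simp add: norm_divide divide_right_mono norm_sum del: norm_mult)
  finally show ?thesis by (simp add: norm_mult a_def \<phi>_def)
qed

section \<open>Exponential decay of the characteristic function of the partial sum\<close>

text \<open>Both \<open>\<pi>j/d\<close> and its reflection \<open>\<pi> - \<pi>j/d\<close> lie
  between \<open>\<pi>/d\<close> and \<open>\<pi>\<close>, where cosine decreases; the reflection
  handles the negative sign.\<close>

lemma abs_cos_pi_fraction_le:
  assumes "1 \<le> j" "j < d"
  shows "\<bar>cos (pi * real j / real d)\<bar> \<le> cos (pi / real d)"
proof -
  let ?x = "pi * real j / real d"
  have "1 * pi \<le> real j * pi" "real (Suc j) * pi \<le> real d * pi"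
    using assms by (intro mult_right_mono; simp)+
  then have x: "pi / real d \<le> ?x" "pi / real d \<le> pi - ?x"
    using assms by (auto simp: field_simps)
  have pi0: "0 \<le> pi / real d" by simp
  have "cos ?x \<le> cos (pi / real d)" "cos (pi - ?x) \<le> cos (pi / real d)"
    using x by (intro cos_monotone_0_pi_le; use pi0 in linarith)+
  then show ?thesis by (simp add: abs_le_iff)
qed

text \<open>Independence gives a product of characteristic functions, and
  \<open>1 - y \<le> exp (- y)\<close> turns the bounds on the factors into an exponential of a
  sum.\<close>

lemma (in prob_space) norm_char_partial_sum_le:
  fixes X :: "nat \<Rightarrow> 'a \<Rightarrow> int"
  assumes X: "indep_vars (\<lambda>_. count_space UNIV) X {1..}"
  shows "norm (char (distr M borel (\<lambda>\<omega>. real_of_int (partial_sum X n \<omega>))) t)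
    \<le> exp (- (nu M X n * (1 - \<bar>cos (t / 2)\<bar>)))"
proof -
  have "indep_vars (\<lambda>_. borel) (\<lambda>i \<omega>. real_of_int (X i \<omega>)) {1..n}"
    by (rule indep_vars_compose2[OF indep_vars_subset[OF X]]) auto
  from char_distr_sum[OF this, of t]
  have "norm (char (distr M borel (\<lambda>\<omega>. real_of_int (partial_sum X n \<omega>))) t)
      = (\<Prod>i = 1..n. norm (char (distr M borel (\<lambda>\<omega>. real_of_int (X i \<omega>))) t))"
    by (simp add: partial_sum_def prod_norm)
  also have "\<dots> \<le> (\<Prod>i = 1..n. exp (- (vartheta M (X i) * (1 - \<bar>cos (t / 2)\<bar>))))"
  proof (intro prod_mono conjI norm_ge_zero)
    fix i assume "i \<in> {1..n}"
    then have "X i \<in> measurable M (count_space UNIV)"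
      using X by (auto simp: indep_vars_def)
    from norm_char_int_valued_le[OF this, of t]
    show "norm (char (distr M borel (\<lambda>\<omega>. real_of_int (X i \<omega>))) t)
        \<le> exp (- (vartheta M (X i) * (1 - \<bar>cos (t / 2)\<bar>)))"
      using exp_ge_add_one_self[of "- (vartheta M (X i) * (1 - \<bar>cos (t / 2)\<bar>))"] by linarith
  qed
  also have "\<dots> = exp (- (nu M X n * (1 - \<bar>cos (t / 2)\<bar>)))"
    by (simp add: exp_sum[symmetric] nu_def sum_negf sum_distrib_right)
  finally show ?thesis .
qed

text \<open>
  The range of \<open>d\<close> says precisely that \<open>\<pi> / (2d)\<close> exceeds the endpoint of the interval on which
  the lower bound for the cardinal sine is assumed.
\<close>

lemma nu_mult_one_minus_cos_ge:
  fixes \<nu> \<rho> \<epsilon> :: real and d :: nat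
  assumes "\<nu> > 0" "\<epsilon> < 1" "d \<ge> 2"
    and d: "real d < pi / sqrt 2 * ((1 - \<epsilon>) * \<nu>) powr ((1 - \<rho>) / 2)"
    and sinc: "\<And>x::real. \<bar>x\<bar> \<le> 1 / 2 * sqrt (2 / ((1 - \<epsilon>) * \<nu>) powr (1 - \<rho>))
           \<Longrightarrow> sinc x \<ge> sqrt (1 - \<epsilon>)"
  shows "((1 - \<epsilon>) * \<nu>) powr \<rho> \<le> \<nu> * (1 - cos (pi / real d))"
proof -
  define N where "N = (1 - \<epsilon>) * \<nu>"
  have N: "N > 0" using assms by (simp add: N_def)
  define r where "r = N powr ((1 - \<rho>) / 2)"
  have r: "r > 0" using N by (simp add: r_def)
  have r2: "r\<^sup>2 = N powr (1 - \<rho>)"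
    using N by (simp add: r_def power2_eq_square powr_add[symmetric])
  \<comment> \<open>The right endpoint of the interval in the sine hypothesis.\<close>
  define x where "x = 1 / 2 * sqrt (2 / N powr (1 - \<rho>))"
  have x: "x = sqrt 2 / (2 * r)"
    using r by (simp add: x_def r2[symmetric] real_sqrt_divide)
  have x0: "x > 0" using r by (simp add: x)
  have x2: "2 * x\<^sup>2 = 1 / N powr (1 - \<rho>)"
    by (simp add: x power_divide power_mult_distrib r2)
  have "real d * sqrt 2 < pi * r"
    using d by (simp add: r_def N_def field_simps)
  then have "sqrt 2 * real d < pi * r" by (simp add: mult.commute)
  then have xd: "x \<le> pi / (2 * real d)"
    using r \<open>d \<ge> 2\<close> by (simp add: x field_simps)
  \<comment> \<open>With \<open>d \<ge> 2\<close> this point stays in the range where sine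
    increases.\<close>
  have "pi / (2 * real d) \<le> pi / 2"
    using \<open>d \<ge> 2\<close> by (simp add: field_simps)
  then have sin: "sin x \<le> sin (pi / (2 * real d))"
    using x0 xd by (intro sin_monotone_2pi_le) auto
  have "sqrt (1 - \<epsilon>) \<le> sin x / x"
    using sinc[of x] x0 by (simp add: x_def N_def)
  then have "sqrt (1 - \<epsilon>) * x \<le> sin (pi / (2 * real d))"
    using sin x0 by (simp add: field_simps)
  then have "(sqrt (1 - \<epsilon>) * x)\<^sup>2 \<le> (sin (pi / (2 * real d)))\<^sup>2"
    using x0 assms by (intro power_mono) auto
  then have "(1 - \<epsilon>) * (2 * x\<^sup>2) \<le> 2 * (sin (pi / (2 * real d)))\<^sup>2"
    using assms by (simp add: power_mult_distrib)
  also have "\<dots> = 1 - cos (pi / real d)"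
    using cos_double_sin[of "pi / (2 * real d)"] by simp
  finally have "\<nu> * ((1 - \<epsilon>) * (2 * x\<^sup>2)) \<le> \<nu> * (1 - cos (pi / real d))"
    using assms by (intro mult_left_mono) auto
  \<comment> \<open>Here \<open>2 * x\<^sup>2\<close> is the inverse of
    \<open>N powr (1 - \<rho>)\<close>, so one factor \<open>N\<close> leaves exactly
    \<open>N powr \<rho>\<close>.\<close>
  also have "\<nu> * ((1 - \<epsilon>) * (2 * x\<^sup>2)) = N / N powr (1 - \<rho>)"
    by (simp add: x2 N_def)
  also have "\<dots> = N powr \<rho>"
    using N powr_diff[of N 1 "1 - \<rho>"] by simp
  finally show ?thesis by (simp add: N_def)
qed

section \<open>The bound uniform in shift and modulus\<close>

theorem theorem4p6:
  fixes M :: "'a measure" and X :: "nat \<Rightarrow> 'a \<Rightarrow> int"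
    and \<rho> \<epsilon> :: real and n :: nat
  assumes "prob_space M"
    and "prob_space.indep_vars M (\<lambda>_. count_space UNIV) X {1..}"
    and "\<And>j. j \<ge> 1 \<Longrightarrow> vartheta M (X j) > 0"
    and "\<not> summable (\<lambda>j. vartheta M (X (Suc j)))"
    and "0 < \<rho>" "\<rho> < 1"
    and "0 < \<epsilon>" "\<epsilon> < 1"
    and "n \<ge> 1"
    and "\<And>x::real. \<bar>x\<bar> \<le> 1 / 2 * sqrt (2 / ((1 - \<epsilon>) * nu M X n) powr (1 - \<rho>))
           \<Longrightarrow> sinc x \<ge> sqrt (1 - \<epsilon>)"
  shows "(SUP u\<in>(UNIV :: nat set).
            SUP d\<in>{d::nat. d \<ge> 1 \<and>
                     real d < pi / sqrt 2 * ((1 - \<epsilon>) * nu M X n) powr ((1 - \<rho>) / 2)}.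
              ennreal \<bar>measure M {\<omega> \<in> space M. int d dvd partial_sum X n \<omega> + int u}
                        - 1 / real d\<bar>)
         \<le> ennreal (2 * exp (- (\<epsilon>\<^sup>2 / 2) * nu M X n)
                     + exp (- (((1 - \<epsilon>) * nu M X n) powr \<rho>)))"
proof (intro SUP_least ennreal_leI)
  interpret prob_space M by fact
  \<comment> \<open>Suprema in \<open>ennreal\<close> need no boundedness check, and an empty range
    of \<open>d\<close> gives \<open>0\<close>; a bound for each pair \<open>u\<close>,
    \<open>d\<close> suffices.\<close>
  fix u d :: nat
  let ?\<nu> = "nu M X n"
  let ?E = "exp (- (((1 - \<epsilon>) * ?\<nu>) powr \<rho>))"
  assume "d \<in> {d. d \<ge> 1 \<and> real d < pi / sqrt 2 * ((1 - \<epsilon>) * ?\<nu>) powr ((1 - \<rho>) / 2)}"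
  then have d: "d \<ge> 1" "real d < pi / sqrt 2 * ((1 - \<epsilon>) * ?\<nu>) powr ((1 - \<rho>) / 2)"
    by auto
  have \<nu>: "?\<nu> > 0"
    unfolding nu_def using assms(3,9) by (intro sum_pos) auto
  have [measurable]: "X i \<in> measurable M (count_space UNIV)" if "i \<in> {1..n}" for i
    using assms(2) that by (auto simp: indep_vars_def)
  have S: "partial_sum X n \<in> measurable M (count_space UNIV)"
    unfolding partial_sum_def[abs_def] by (rule measurable_sum_int) simp_all
  have char: "norm (char (distr M borel (\<lambda>\<omega>. real_of_int (partial_sum X n \<omega>)))
      (2 * pi * real j / real d)) \<le> ?E" if j: "j \<in> {1..<d}" for j
  proof -
    have "\<bar>cos (2 * pi * real j / real d / 2)\<bar> \<le> cos (pi / real d)"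
      using abs_cos_pi_fraction_le[of j d] j by simp
    then have "?\<nu> * (1 - cos (pi / real d)) \<le> ?\<nu> * (1 - \<bar>cos (2 * pi * real j / real d / 2)\<bar>)"
      using \<nu> by (intro mult_left_mono) auto
    moreover have "((1 - \<epsilon>) * ?\<nu>) powr \<rho> \<le> ?\<nu> * (1 - cos (pi / real d))"
      \<comment> \<open>The existence of \<open>j\<close> with \<open>1 \<le> j < d\<close> supplies
        \<open>d \<ge> 2\<close>; for \<open>d = 1\<close> the sum over \<open>j\<close> is
        empty.\<close>
      by (rule nu_mult_one_minus_cos_ge[OF \<nu> assms(8) _ d(2) assms(10)]) (use j in auto)
    ultimately have "exp (- (?\<nu> * (1 - \<bar>cos (2 * pi * real j / real d / 2)\<bar>))) \<le> ?E"
      by simp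
    with norm_char_partial_sum_le[OF assms(2)] show ?thesis
      by (rule order_trans)
  qed
  have "\<bar>prob {\<omega> \<in> space M. int d dvd partial_sum X n \<omega> + int u} - 1 / real d\<bar>
      \<le> (\<Sum>j\<in>{1..<d}. ?E) / real d"
    by (rule order_trans[OF prob_dvd_diff_le[OF S d(1)]])
       (intro divide_right_mono sum_mono char; simp)
  \<comment> \<open>There are \<open>d - 1\<close> equal terms, divided by \<open>d\<close>.\<close>
  also have "\<dots> \<le> ?E"
    using d(1) by (simp add: field_simps)
  also have "\<dots> \<le> 2 * exp (- (\<epsilon>\<^sup>2 / 2) * ?\<nu>) + ?E"
    by simp
  finally show "\<bar>prob {\<omega> \<in> space M. int d dvd partial_sum X n \<omega> + int u} - 1 / real d\<bar>
      \<le> 2 * exp (- (\<epsilon>\<^sup>2 / 2) * ?\<nu>) + ?E" .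
qed

end
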